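(* Let $n\ge1$ and let $G=(V,E)$ and $H=(V,F)$ be graphs on the common node set $V=\{1,\dots,n\}$ such that the edges of $H$ are pairwise node-disjoint. Let $t=\lvert F\rvert$, $k=n-t$, and let $V=V_1\cup\dots\cup V_k$ be the decomposition of $V$ into the node sets of the connected components of $H$. Assume that $E$ consists of exactly $\binom{k}{2}$ edges, namely for each $1\le i<j\le k$ exactly one edge $e_{ij}$, which joins a node of $V_i$ and a node of $V_j$. Let $I(G,H)$ denote the inequality, in variables $x_{uv}$ indexed by the edges of the complete graph on $V\cup\{n+1\}$, \[ \sum_{uv\in E} T(u,v;n+1)-\sum_{uv\in F}T(u,v;n+1)+2\sum_{i:\,V_i=\{u\}}x_{u,n+1}\le 2, \] where $T(u,v;w)=x_{uv}-x_{uw}-x_{vw}$ and the last sum runs over the components $V_i$ consisting of a single node $u$. Assume $k\ge3$. Then $I(G,H)$ defines a facet of $\mathrm{CUT}^\square_{n+1}$ if and only if every node of $G$ has degree at least two in $G$.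
   Context: For a graph with node set $W$ and edge set $D$, the cut vector $\boldsymbol{\delta}(S)\in\mathbb{R}^D$ of $S\subseteq W$ has $\delta_{uv}(S)=1$ if exactly one of $u,v$ lies in $S$, and $0$ otherwise. $\mathrm{CUT}^\square_N$ is the cut polytope of $\mathrm{K}_N$: the convex hull of all cut vectors of subsets of the node set of $\mathrm{K}_N$, in $\mathbb{R}^{E(\mathrm{K}_N)}$; here the nodes of $\mathrm{K}_{n+1}$ are $V\cup\{n+1\}$. An inequality is a facet of a polytope $P$ if it is valid for $P$ and the set of points of $P$ satisfying it with equality has dimension $\dim P-1$. *)

theory Defs
  imports "HOL-Analysis.Analysis"
begin

text \<open>Graphs are simple, with node set the whole (finite) type and edges given as two-element
  node sets.\<close>

definition graph_edges :: "'v set set \<Rightarrow> bool" where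
  "graph_edges D \<longleftrightarrow> (\<forall>e\<in>D. card e = 2)"

definition complete_edges :: "'v set set" where
  "complete_edges = {e. card e = 2}"

definition graph_degree :: "'v set set \<Rightarrow> 'v \<Rightarrow> nat" where
  "graph_degree D v = card {e \<in> D. v \<in> e}"

definition adjacency :: "'v set set \<Rightarrow> ('v \<times> 'v) set" where
  "adjacency D = {(u, v). {u, v} \<in> D}"

definition graph_components :: "'v set set \<Rightarrow> 'v set set" where
  "graph_components D = UNIV // (adjacency D)\<^sup>*"

definition joins :: "'v set \<Rightarrow> 'v set \<Rightarrow> 'v set \<Rightarrow> bool" where
  "joins e A B \<longleftrightarrow> (\<exists>u\<in>A. \<exists>v\<in>B. e = {u, v})"

text \<open>The space of real vectors indexed by \<open>D\<close> is realised as the coordinate subspace of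
  \<open>real ^ 'w set\<close> of the vectors that vanish outside \<open>D\<close>; this changes neither convex hulls nor
  affine dimensions.\<close>

definition cut_vector :: "'w::finite set set \<Rightarrow> 'w set \<Rightarrow> real ^ 'w set" where
  "cut_vector D S =
     (\<chi> e. if e \<in> D \<and> (\<exists>u v. e = {u, v} \<and> u \<in> S \<and> v \<notin> S) then 1 else 0)"

definition cut_polytope :: "(real ^ 'w::finite set) set" where
  "cut_polytope = convex hull (range (cut_vector complete_edges))"

text \<open>The inequality in question is \<open>f x \<le> b\<close>.\<close>

definition defines_facet ::
    "('a::euclidean_space \<Rightarrow> real) \<Rightarrow> real \<Rightarrow> 'a set \<Rightarrow> bool" where
  "defines_facet f b P \<longleftrightarrow>
     (\<forall>x\<in>P. f x \<le> b) \<and> aff_dim {x \<in> P. f x = b} = aff_dim P - 1"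

text \<open>\<open>triangle x {u, v} w\<close> is \<open>T(u, v; w)\<close>; taking the unordered pair as argument makes
  sums over edges well defined.\<close>

definition triangle :: "real ^ 'w::finite set \<Rightarrow> 'w set \<Rightarrow> 'w \<Rightarrow> real" where
  "triangle x e w = x $ e - (\<Sum>u\<in>e. x $ {u, w})"

lemma triangle_pair:
  "u \<noteq> v \<Longrightarrow> triangle x {u, v} w = x $ {u, v} - x $ {u, w} - x $ {v, w}"
  by (simp add: triangle_def)

text \<open>The nodes of the large complete graph form the type \<open>'v option\<close>: \<open>Some u\<close> is the node \<open>u\<close>
  of \<open>V\<close>, and \<open>None\<close> is the extra node \<open>n + 1\<close>.\<close>

definition I_lhs :: "'v::finite set set \<Rightarrow> 'v set set \<Rightarrow> real ^ 'v option set \<Rightarrow> real" where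
  "I_lhs E F x =
     (\<Sum>e\<in>E. triangle x (Some ` e) None) - (\<Sum>e\<in>F. triangle x (Some ` e) None)
     + 2 * (\<Sum>u | {u} \<in> graph_components F. x $ {Some u, None})"

end

theory Submission
  imports Defs
begin

text \<open>At the cut of a set \<open>S\<close> of nodes avoiding the extra node, half the left-hand side is the
  number of components of \<open>H\<close> contained in \<open>S\<close> minus the number of edges of \<open>G\<close> inside \<open>S\<close>.
  If \<open>m\<close> components are contained in \<open>S\<close>, at least \<open>m choose 2\<close> edges are; so the inequality is
  valid, and \<open>S\<close> is tight iff \<open>m\<close> is 1 or 2 and the only edges inside \<open>S\<close> are those between
  contained components. In the coordinates of the correlation polytope a linear functional is a
  quadratic form in the indicator of \<open>S\<close>, so the inequality is a facet iff every quadratic form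
  vanishing on all tight sets is zero. If all degrees are at least two, enlarging one or two
  components by at most two further nodes gives enough tight sets to kill all coefficients. A node
  of smaller degree yields a triangle inequality that is an equation on all tight cuts.\<close>

section \<open>Facets of polytopes and linear functionals\<close>

text \<open>Because \<open>b\<close> is nonzero, the hyperplane misses the origin, so the face has
  affine dimension one less than the dimension of its span, while \<open>0 \<in> V\<close> makes the
  affine dimension of the polytope that of its span. Being a facet then means that the tight points
  of \<open>V\<close> span all of \<open>span V\<close>, which linear functionals can test.\<close>

lemma facet_criterion:
  fixes f :: "'a::euclidean_space \<Rightarrow> real"
  assumes "linear f" "finite V" "0 \<in> V" "b \<noteq> 0" and valid: "\<And>x. x \<in> V \<Longrightarrow> f x \<le> b"
  shows "defines_facet f b (convex hull V) \<longleftrightarrow>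
    (\<forall>a. (\<forall>x\<in>V. f x = b \<longrightarrow> a \<bullet> x = 0) \<longrightarrow> (\<forall>x\<in>V. a \<bullet> x = 0))"
proof -
  define P where "P = convex hull V"
  define Q where "Q = {x \<in> P. f x = b}"
  define T where "T = {x \<in> V. f x = b}"
  have lin_sum: "f (\<Sum>v\<in>V. u v *\<^sub>R v) = (\<Sum>v\<in>V. u v * f v)" for u
    using \<open>linear f\<close> by (simp add: linear_sum linear_scale)
  have P_rep: "\<exists>u. (\<forall>v\<in>V. 0 \<le> u v) \<and> sum u V = 1 \<and> (\<Sum>v\<in>V. u v *\<^sub>R v) = x" if "x \<in> P" for x
    using that \<open>finite V\<close> by (auto simp: P_def convex_hull_finite)
  have valid_P: "f x \<le> b" if x: "x \<in> P" for x
  proof -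
    obtain u where u: "\<forall>v\<in>V. 0 \<le> u v" "sum u V = 1" "(\<Sum>v\<in>V. u v *\<^sub>R v) = x"
      using P_rep[OF x] by blast
    have "f x = (\<Sum>v\<in>V. u v * f v)" using lin_sum u(3) by metis
    also have "\<dots> \<le> (\<Sum>v\<in>V. u v * b)"
      using u(1) valid by (intro sum_mono mult_left_mono) auto
    also have "\<dots> = b" using u(2) by (simp flip: sum_distrib_right)
    finally show ?thesis .
  qed
  \<comment> \<open>In a convex combination attaining \<open>b\<close>, the defects
    \<open>b - f v\<close> are nonnegative with weighted sum zero, so points with positive defect
    carry weight zero.\<close>
  have "Q \<subseteq> span T"
  proof
    fix x assume "x \<in> Q"
    then have x: "x \<in> P" "f x = b" by (auto simp: Q_def)
    obtain u where u: "\<forall>v\<in>V. 0 \<le> u v" "sum u V = 1" "(\<Sum>v\<in>V. u v *\<^sub>R v) = x"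
      using P_rep[OF x(1)] by blast
    have "(\<Sum>v\<in>V. u v * (b - f v)) = sum u V * b - (\<Sum>v\<in>V. u v * f v)"
      by (simp add: right_diff_distrib sum_subtractf sum_distrib_right)
    also have "\<dots> = 0" using lin_sum[of u] u x(2) by simp
    finally have "(\<Sum>v\<in>V. u v * (b - f v)) = 0" .
    moreover have "0 \<le> u v * (b - f v)" if "v \<in> V" for v
      using u(1) valid[OF that] that by simp
    ultimately have "\<forall>v\<in>V. u v * (b - f v) = 0"
      using sum_nonneg_eq_0_iff[OF \<open>finite V\<close>, of "\<lambda>v. u v * (b - f v)"] by simp
    then have "u v *\<^sub>R v \<in> span T" if "v \<in> V" for v
      using that by (cases "f v = b") (auto simp: T_def span_zero intro: span_scale span_base)
    then have "(\<Sum>v\<in>V. u v *\<^sub>R v) \<in> span T" by (rule span_sum)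
    then show "x \<in> span T" using u(3) by simp
  qed
  moreover have "T \<subseteq> Q" by (auto simp: T_def Q_def P_def hull_inc)
  ultimately have span_Q: "span Q = span T" by (metis span_mono span_span subset_antisym)
  have "P \<subseteq> span V" unfolding P_def by (rule convex_hull_subset_span)
  then have span_P: "span P = span V"
    by (metis P_def hull_subset span_mono span_span subset_antisym)
  have aff_P: "aff_dim P = int (dim P)"
    using \<open>0 \<in> V\<close> by (intro aff_dim_zero) (simp add: P_def hull_inc)
  have "affine {x. f x = b}"
    using \<open>linear f\<close> by (auto simp: affine_def linear_add linear_scale simp flip: distrib_right)
  then have "affine hull Q \<subseteq> {x. f x = b}" by (intro hull_minimal) (auto simp: Q_def)
  then have "0 \<notin> affine hull Q" using \<open>b \<noteq> 0\<close> linear_0[OF \<open>linear f\<close>] by auto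
  then have "aff_dim Q + 1 = aff_dim (insert 0 Q)" by (simp add: aff_dim_insert)
  also have "\<dots> = int (dim Q)"
    by (subst aff_dim_zero) (auto simp: hull_inc dim_insert span_0)
  finally have aff_Q: "aff_dim Q + 1 = int (dim Q)" .
  have "defines_facet f b P \<longleftrightarrow> aff_dim Q = aff_dim P - 1"
    using valid_P unfolding defines_facet_def Q_def by blast
  also have "\<dots> \<longleftrightarrow> dim Q = dim P" using aff_Q aff_P by linarith
  also have "\<dots> \<longleftrightarrow> dim (span T) = dim (span V)" by (metis dim_span span_P span_Q)
  also have "\<dots> \<longleftrightarrow> \<not> span T \<subset> span V"
  proof -
    have "span T \<subseteq> span V" by (intro span_mono) (auto simp: T_def)
    then show ?thesis by (metis dim_psubset dim_span less_irrefl psubsetI span_span)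
  qed
  also have "\<dots> \<longleftrightarrow> (\<forall>a. (\<forall>x\<in>T. a \<bullet> x = 0) \<longrightarrow> (\<forall>x\<in>V. a \<bullet> x = 0))"
  proof
    assume "\<not> span T \<subset> span V"
    moreover have "span T \<subseteq> span V" by (intro span_mono) (auto simp: T_def)
    ultimately have "V \<subseteq> span T" using span_superset by blast
    then show "\<forall>a. (\<forall>x\<in>T. a \<bullet> x = 0) \<longrightarrow> (\<forall>x\<in>V. a \<bullet> x = 0)"
      by (metis orthogonal_def orthogonal_to_span subsetD)
  next
    assume *: "\<forall>a. (\<forall>x\<in>T. a \<bullet> x = 0) \<longrightarrow> (\<forall>x\<in>V. a \<bullet> x = 0)"
    show "\<not> span T \<subset> span V"
    proof
      assume "span T \<subset> span V"
      \<comment> \<open>A vector of \<open>span V\<close> orthogonal to \<open>span T\<close>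
        annihilates \<open>V\<close> by hypothesis, hence is orthogonal to itself.\<close>
      then obtain a where a: "a \<noteq> 0" "a \<in> span V" "\<And>y. y \<in> span T \<Longrightarrow> orthogonal a y"
        using orthogonal_to_subspace_exists_gen by blast
      then have "\<forall>x\<in>V. a \<bullet> x = 0" using * by (simp add: orthogonal_def span_base)
      then have "orthogonal a a" using a(2) by (metis orthogonal_def orthogonal_to_span)
      then show False using a(1) by (simp add: orthogonal_def)
    qed
  qed
  finally show ?thesis by (auto simp: P_def T_def)
qed

section \<open>Cut vectors and quadratic forms\<close>

lemma cut_vector_pair:
  "p \<noteq> q \<Longrightarrow> cut_vector complete_edges S $ {p, q} = of_bool ((p \<in> S) \<noteq> (q \<in> S))"
  by (auto simp: cut_vector_def complete_edges_def doubleton_eq_iff)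

lemma cut_vector_Compl: "cut_vector D (- S) = cut_vector D S"
  by (auto simp: cut_vector_def vec_eq_iff insert_commute)

lemma Compl_image_Some: "- Some ` S = insert None (Some ` (- S))"
proof (rule set_eqI)
  show "x \<in> - Some ` S \<longleftrightarrow> x \<in> insert None (Some ` (- S))" for x by (cases x) auto
qed

lemma image_Some_vimage:
  assumes "None \<notin> S"
  shows "Some ` (Some -` S) = S"
proof (rule set_eqI)
  show "x \<in> Some ` (Some -` S) \<longleftrightarrow> x \<in> S" for x using assms by (cases x) auto
qed

text \<open>A set and its complement have the same cut vector, so the side avoiding the extra node
  can always be chosen.\<close>

lemma range_cut_vector_option:
  "range (cut_vector D) = range (\<lambda>S. cut_vector D (Some ` S))"
proof -
  have "\<exists>R. cut_vector D S = cut_vector D (Some ` R)" for S :: "'a option set"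
  proof (cases "None \<in> S")
    case True
    then have "Some ` (Some -` (- S)) = - S" by (intro image_Some_vimage) simp
    then have "cut_vector D S = cut_vector D (Some ` (Some -` (- S)))"
      by (simp add: cut_vector_Compl)
    then show ?thesis by (rule exI)
  next
    case False
    then have "cut_vector D S = cut_vector D (Some ` (Some -` S))"
      by (simp only: image_Some_vimage not_False_eq_True)
    then show ?thesis by (rule exI)
  qed
  then show ?thesis by (auto simp: image_iff)
qed

text \<open>A cut edge has exactly one end in \<open>S\<close>, so the ordered pairs in
  \<open>S \<times> - S\<close> enumerate the cut edges without repetition.\<close>

lemma inner_cut_vector:
  "a \<bullet> cut_vector complete_edges S = (\<Sum>p\<in>S. \<Sum>q\<in>-S. a $ {p, q})"
proof -
  define K where "K = (\<lambda>(p, q). {p, q}) ` (S \<times> - S)"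
  have inj: "inj_on (\<lambda>(p, q). {p, q}) (S \<times> - S)"
    by (auto simp: inj_on_def doubleton_eq_iff)
  have "cut_vector complete_edges S $ e = of_bool (e \<in> K)" for e
    by (auto simp: cut_vector_def complete_edges_def K_def image_iff card_2_iff)
  then have "a \<bullet> cut_vector complete_edges S = (\<Sum>e\<in>UNIV. a $ e * of_bool (e \<in> K))"
    by (simp add: inner_vec_def)
  also have "\<dots> = (\<Sum>e\<in>K. a $ e)"
    by (intro sum.mono_neutral_cong_right) auto
  also have "\<dots> = (\<Sum>(p, q)\<in>S \<times> - S. a $ {p, q})"
    unfolding K_def by (subst sum.reindex[OF inj]) (simp add: case_prod_beta)
  finally show ?thesis by (simp add: sum.cartesian_product)
qed

text \<open>This is the covariance map to correlation coordinates. The edges leaving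
  \<open>S\<close> at a node of \<open>S\<close> are its full row minus the part inside
  \<open>S\<close>; the row total goes on the diagonal of the form.\<close>

lemma inner_cut_vector_quadratic:
  fixes a :: "real ^ 'v::finite option set"
  obtains b :: "'v \<Rightarrow> 'v \<Rightarrow> real" where "\<And>u v. b u v = b v u"
    "\<And>S. a \<bullet> cut_vector complete_edges (Some ` S) = (\<Sum>u\<in>S. \<Sum>v\<in>S. b u v)"
proof
  \<comment> \<open>The sum over all \<open>v\<close> includes the singleton coordinate
    \<open>{Some u}\<close>, which cancels against the one subtracted in
    \<open>b u u\<close>.\<close>
  define c where "c u = a $ {Some u, None} + (\<Sum>v\<in>UNIV. a $ {Some u, Some v})" for u
  define b where "b u v = (if u = v then c u else 0) - a $ {Some u, Some v}" for u v
  show "b u v = b v u" for u v by (simp add: b_def insert_commute)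
  show "a \<bullet> cut_vector complete_edges (Some ` S) = (\<Sum>u\<in>S. \<Sum>v\<in>S. b u v)" for S
  proof -
    have "a \<bullet> cut_vector complete_edges (Some ` S)
        = (\<Sum>u\<in>S. a $ {Some u, None} + (\<Sum>v\<in>-S. a $ {Some u, Some v}))"
      by (simp add: inner_cut_vector sum.reindex Compl_image_Some)
    also have "\<dots> = (\<Sum>u\<in>S. c u - (\<Sum>v\<in>S. a $ {Some u, Some v}))"
      by (intro sum.cong) (simp_all add: c_def Compl_eq_Diff_UNIV sum_diff)
    also have "\<dots> = (\<Sum>u\<in>S. \<Sum>v\<in>S. b u v)"
      by (intro sum.cong) (simp_all add: b_def sum_subtractf)
    finally show ?thesis .
  qed
qed

section \<open>Components of a matching, and a binomial bound\<close>

text \<open>For pairwise disjoint edges, adjacency together with \<open>Id\<close> is already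
  transitive, so the closure adds nothing more and each class is an edge or an uncovered
  node.\<close>

lemma graph_components_matching:
  assumes "graph_edges F" "pairwise disjnt F"
  shows "graph_components F = F \<union> {{u} | u. u \<notin> \<Union>F}"
proof -
  have disj: "e = e'" if "e \<in> F" "e' \<in> F" "x \<in> e" "x \<in> e'" for e e' x
    using assms(2) that by (auto simp: pairwise_def disjnt_def)
  have trans: "trans (Id \<union> adjacency F)"
  proof (rule transI)
    fix x y z assume "(x, y) \<in> Id \<union> adjacency F" "(y, z) \<in> Id \<union> adjacency F"
    moreover have "x = z" if "{x, y} \<in> F" "{y, z} \<in> F"
      using disj[OF that, of y] by (auto simp: doubleton_eq_iff)
    ultimately show "(x, z) \<in> Id \<union> adjacency F" by (auto simp: adjacency_def)
  qed
  have "(x, y) \<in> Id \<union> adjacency F" if "(x, y) \<in> (adjacency F)\<^sup>*" for x y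
    using that
  proof (induction rule: rtrancl_induct)
    case (step y z)
    then show ?case using transD[OF trans] by blast
  qed simp
  then have star: "(adjacency F)\<^sup>* = Id \<union> adjacency F" by auto
  have cls: "(adjacency F)\<^sup>* `` {x} = insert x {y. {x, y} \<in> F}" for x
    unfolding star by (auto simp: adjacency_def)
  have in_F: "insert x {y. {x, y} \<in> F} = e" if "x \<in> e" "e \<in> F" for x e
  proof -
    have "card e = 2" using assms(1) that(2) by (simp add: graph_edges_def)
    then obtain p q where pq: "e = {p, q}" by (meson card_2_iff)
    then have "x = p \<or> x = q" using that(1) by simp
    then obtain y where y: "e = {x, y}" using pq by (metis insert_commute)
    have "{x, y'} \<in> F \<longleftrightarrow> y' = y" for y'
      using disj[of "{x, y'}" e x] that y by (auto simp: doubleton_eq_iff)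
    then show ?thesis using y by simp
  qed
  have not_F: "insert x {y. {x, y} \<in> F} = {x}" if "x \<notin> \<Union>F" for x using that by auto
  have nonempty: "\<exists>x. x \<in> e" if "e \<in> F" for e
    using assms(1) that by (metis card.empty equals0I graph_edges_def zero_neq_numeral)
  show ?thesis
  proof (intro subset_antisym subsetI)
    fix C assume "C \<in> graph_components F"
    then obtain x where "C = insert x {y. {x, y} \<in> F}"
      by (auto simp: graph_components_def quotient_def cls)
    then show "C \<in> F \<union> {{u} | u. u \<notin> \<Union>F}"
      using in_F[of x] not_F[of x] by (cases "x \<in> \<Union>F") auto
  next
    fix C assume "C \<in> F \<union> {{u} | u. u \<notin> \<Union>F}"
    then have "\<exists>x. C = insert x {y. {x, y} \<in> F}"
    proof
      assume "C \<in> F"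
      then show ?thesis using nonempty[of C] in_F[of _ C] by metis
    next
      assume "C \<in> {{u} | u. u \<notin> \<Union>F}"
      then show ?thesis using not_F by blast
    qed
    then show "C \<in> graph_components F"
      by (auto simp: graph_components_def quotient_def cls)
  qed
qed

lemma le_choose_2:
  fixes m :: nat
  assumes "3 \<le> m"
  shows "m \<le> m choose 2"
proof -
  have "m * 2 div 2 \<le> m * (m - 1) div 2" using assms by (intro div_le_mono mult_le_mono) auto
  then show ?thesis by (simp add: choose_two)
qed

text \<open>Equality holds exactly for \<open>m = 1\<close> and \<open>m = 2\<close>; this is where
  the possible numbers of components contained in a tight set come from.\<close>

lemma le_Suc_choose_2: "m \<le> 1 + (m choose 2)" for m :: nat
proof (cases "3 \<le> m")
  case False
  then have "m = 0 \<or> m = 1 \<or> m = 2" by linarith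
  then show ?thesis by auto
qed (use le_choose_2 in \<open>simp add: le_SucI\<close>)

section \<open>Components joined pairwise by single edges\<close>

text \<open>The graph \<open>H\<close> enters only through the family \<open>\<C>\<close> of node
  sets of its components. The edge count of \<open>G\<close> is replaced by its consequence
  \<open>edge_joins\<close>, which rules out edges inside a component.\<close>

locale component_graph =
  fixes \<C> E :: "'v::finite set set"
  assumes partition: "partition_on UNIV \<C>"
    and card_component: "\<And>C. C \<in> \<C> \<Longrightarrow> card C = 1 \<or> card C = 2"
    and edge_ex1: "\<And>A B. \<lbrakk>A \<in> \<C>; B \<in> \<C>; A \<noteq> B\<rbrakk> \<Longrightarrow> \<exists>!e. e \<in> E \<and> joins e A B"
    and edge_joins: "\<And>e. e \<in> E \<Longrightarrow> \<exists>A\<in>\<C>. \<exists>B\<in>\<C>. A \<noteq> B \<and> joins e A B"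
    and card_components: "3 \<le> card \<C>"
begin

lemma component_unique: "\<lbrakk>A \<in> \<C>; B \<in> \<C>; x \<in> A; x \<in> B\<rbrakk> \<Longrightarrow> A = B"
  using partition by (auto simp: partition_on_def disjoint_def)

lemma component_ex: "\<exists>A\<in>\<C>. x \<in> A"
  using partition by (auto simp: partition_on_def)

text \<open>Turns the edge set into a function: for distinct components, \<open>port A B\<close> and
  \<open>port B A\<close> are the two ends of the unique edge between them.\<close>

definition port :: "'v set \<Rightarrow> 'v set \<Rightarrow> 'v" where
  "port A B = (THE u. u \<in> A \<and> (\<exists>v\<in>B. {u, v} \<in> E))"

lemma port_eq:
  assumes "A \<in> \<C>" "B \<in> \<C>" "A \<noteq> B" "u \<in> A" "v \<in> B" "{u, v} \<in> E"
  shows "port A B = u"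
  unfolding port_def
proof (rule the_equality)
  fix u' assume "u' \<in> A \<and> (\<exists>v\<in>B. {u', v} \<in> E)"
  then obtain v' where v': "u' \<in> A" "v' \<in> B" "{u', v'} \<in> E" by blast
  then have "{u', v'} = {u, v}"
    using edge_ex1[OF assms(1-3)] assms(4-6) unfolding joins_def by blast
  then show "u' = u" using component_unique assms v' by (metis doubleton_eq_iff)
qed (use assms in blast)

lemma
  assumes "A \<in> \<C>" "B \<in> \<C>" "A \<noteq> B"
  shows port_in: "port A B \<in> A" and port_edge: "{port A B, port B A} \<in> E"
proof -
  obtain u v where uv: "u \<in> A" "v \<in> B" "{u, v} \<in> E"
    using edge_ex1[OF assms] unfolding joins_def by blast
  then have "port A B = u" "port B A = v"
    using port_eq[OF assms] port_eq[OF assms(2,1)] assms(3) by (auto simp: insert_commute)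
  then show "port A B \<in> A" "{port A B, port B A} \<in> E" using uv by auto
qed

lemma edgeE:
  assumes "e \<in> E"
  obtains A B where "A \<in> \<C>" "B \<in> \<C>" "A \<noteq> B" "e = {port A B, port B A}"
proof -
  obtain A B u v where *: "A \<in> \<C>" "B \<in> \<C>" "A \<noteq> B" "u \<in> A" "v \<in> B" "e = {u, v}"
    using edge_joins[OF assms] unfolding joins_def by blast
  moreover have "port A B = u" "port B A = v"
    using port_eq[OF *(1-5)] port_eq[OF *(2,1) not_sym[OF *(3)] *(5,4)] assms *(6)
    by (auto simp: insert_commute)
  ultimately show ?thesis using that by blast
qed

text \<open>An edge at \<open>u\<close> is determined by the component it leads to, because its
  other end \<open>port B A\<close> lies in \<open>B\<close> and components are disjoint.\<close>

lemma graph_degree_port: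
  assumes "A \<in> \<C>" "u \<in> A"
  shows "graph_degree E u = card {B \<in> \<C>. B \<noteq> A \<and> port A B = u}"
proof -
  have "{e \<in> E. u \<in> e} = (\<lambda>B. {u, port B A}) ` {B \<in> \<C>. B \<noteq> A \<and> port A B = u}"
  proof (intro subset_antisym subsetI)
    fix e assume "e \<in> {e \<in> E. u \<in> e}"
    then have "e \<in> E" "u \<in> e" by auto
    from \<open>e \<in> E\<close> obtain C D where CD: "C \<in> \<C>" "D \<in> \<C>" "C \<noteq> D" "e = {port C D, port D C}"
      by (rule edgeE)
    have "(A = C \<and> u = port C D) \<or> (A = D \<and> u = port D C)"
      using component_unique[OF assms(1) CD(1) assms(2)] component_unique[OF assms(1) CD(2) assms(2)]
        port_in[OF CD(1-3)] port_in[OF CD(2,1) not_sym[OF CD(3)]] \<open>u \<in> e\<close> CD(4) by auto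
    then show "e \<in> (\<lambda>B. {u, port B A}) ` {B \<in> \<C>. B \<noteq> A \<and> port A B = u}"
      using CD by (auto simp: insert_commute)
  next
    fix e assume "e \<in> (\<lambda>B. {u, port B A}) ` {B \<in> \<C>. B \<noteq> A \<and> port A B = u}"
    then obtain B where "B \<in> \<C>" "B \<noteq> A" "port A B = u" "e = {u, port B A}" by blast
    then show "e \<in> {e \<in> E. u \<in> e}" using port_edge[of A B] assms by simp
  qed
  moreover have "inj_on (\<lambda>B. {u, port B A}) {B \<in> \<C>. B \<noteq> A \<and> port A B = u}"
  proof (rule inj_onI)
    fix B B' assume "B \<in> {B \<in> \<C>. B \<noteq> A \<and> port A B = u}" "B' \<in> {B \<in> \<C>. B \<noteq> A \<and> port A B = u}"
      and eq: "{u, port B A} = {u, port B' A}"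
    then have B: "B \<in> \<C>" "B \<noteq> A" and B': "B' \<in> \<C>" "B' \<noteq> A" by auto
    have "port B A = port B' A" using eq by (auto simp: doubleton_eq_iff)
    then show "B = B'"
      using component_unique[OF B(1) B'(1)] port_in[OF B(1) assms(1) B(2)] port_in[OF B'(1) assms(1) B'(2)]
      by simp
  qed
  ultimately show ?thesis by (simp add: graph_degree_def card_image)
qed

section \<open>Validity and tight sets\<close>

definition contained :: "'v set \<Rightarrow> 'v set set" where
  "contained S = {C \<in> \<C>. C \<subseteq> S}"

definition induced :: "'v set \<Rightarrow> 'v set set" where
  "induced S = {e \<in> E. e \<subseteq> S}"

text \<open>The components met by an edge recover the pair it joins, so \<open>ends\<close> is a
  bijection onto the two-element subsets of \<open>M\<close>.\<close>

lemma card_edges_between: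
  assumes "M \<subseteq> \<C>"
  shows "card {{port A B, port B A} | A B. A \<in> M \<and> B \<in> M \<and> A \<noteq> B} = card M choose 2"
proof -
  define X where "X = {{port A B, port B A} | A B. A \<in> M \<and> B \<in> M \<and> A \<noteq> B}"
  define ends where "ends e = {C \<in> \<C>. C \<inter> e \<noteq> {}}" for e
  have ends: "ends {port A B, port B A} = {A, B}" if "A \<in> M" "B \<in> M" "A \<noteq> B" for A B
  proof -
    have AB: "A \<in> \<C>" "B \<in> \<C>" using that assms by auto
    have "C \<inter> {port A B, port B A} \<noteq> {} \<longleftrightarrow> C = A \<or> C = B" if "C \<in> \<C>" for C
      using port_in[OF AB] port_in[OF AB(2,1)] \<open>A \<noteq> B\<close> component_unique[OF that AB(1)]
        component_unique[OF that AB(2)] by auto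
    then show ?thesis using AB by (auto simp: ends_def)
  qed
  have "bij_betw ends X {D. D \<subseteq> M \<and> card D = 2}"
  proof (rule bij_betw_imageI)
    show "inj_on ends X"
    proof (rule inj_onI)
      fix e e' assume *: "e \<in> X" "e' \<in> X" "ends e = ends e'"
      obtain A B A' B' where AB: "A \<in> M" "B \<in> M" "A \<noteq> B" "e = {port A B, port B A}"
        and AB': "A' \<in> M" "B' \<in> M" "A' \<noteq> B'" "e' = {port A' B', port B' A'}"
        using * unfolding X_def by blast
      then have "{A, B} = {A', B'}" using ends * by metis
      then show "e = e'" using AB AB' by (auto simp: doubleton_eq_iff)
    qed
    show "ends ` X = {D. D \<subseteq> M \<and> card D = 2}"
    proof (intro subset_antisym subsetI)
      fix D assume "D \<in> {D. D \<subseteq> M \<and> card D = 2}"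
      then obtain A B where "D = {A, B}" "A \<in> M" "B \<in> M" "A \<noteq> B" by (auto simp: card_2_iff)
      then show "D \<in> ends ` X" unfolding X_def using ends by blast
    next
      fix D assume "D \<in> ends ` X"
      then obtain A B where "A \<in> M" "B \<in> M" "A \<noteq> B" "D = ends {port A B, port B A}"
        unfolding X_def by blast
      then show "D \<in> {D. D \<subseteq> M \<and> card D = 2}" using ends[of A B] by simp
    qed
  qed
  then have "card X = card {D. D \<subseteq> M \<and> card D = 2}" by (rule bij_betw_same_card)
  then show ?thesis by (simp add: X_def n_subsets)
qed

lemma edges_between_subset:
  "{{port A B, port B A} | A B. A \<in> contained S \<and> B \<in> contained S \<and> A \<noteq> B} \<subseteq> induced S"
proof
  fix e assume "e \<in> {{port A B, port B A} | A B. A \<in> contained S \<and> B \<in> contained S \<and> A \<noteq> B}"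
  then obtain A B where "e = {port A B, port B A}" "A \<in> \<C>" "B \<in> \<C>" "A \<noteq> B" "A \<subseteq> S" "B \<subseteq> S"
    unfolding contained_def by blast
  then show "e \<in> induced S"
    using port_in[of A B] port_in[of B A] port_edge[of A B] by (auto simp: induced_def)
qed

lemma induced_ge: "card (contained S) choose 2 \<le> card (induced S)"
  using card_mono[OF _ edges_between_subset, of S] card_edges_between[of "contained S"]
  by (auto simp: contained_def)

text \<open>This is the validity of the inequality at a cut, and \<open>tight\<close> is its
  equality case.\<close>

lemma excess_le: "card (contained S) \<le> 1 + card (induced S)"
  using induced_ge[of S] le_Suc_choose_2[of "card (contained S)"] by linarith

definition tight :: "'v set \<Rightarrow> bool" where
  "tight S \<longleftrightarrow> card (contained S) = 1 + card (induced S)"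

text \<open>Three or more contained components leave slack by \<open>le_choose_2\<close>; with one
  or two, equality means that the edges between contained components are all the induced ones. The
  last condition ranges over both orders of \<open>A\<close> and \<open>B\<close>, so concluding
  \<open>A \<subseteq> S\<close> covers both ends.\<close>

lemma tight_iff:
  "tight S \<longleftrightarrow> (card (contained S) = 1 \<or> card (contained S) = 2) \<and>
    (\<forall>A\<in>\<C>. \<forall>B\<in>\<C>. A \<noteq> B \<longrightarrow> port A B \<in> S \<longrightarrow> port B A \<in> S \<longrightarrow> A \<subseteq> S)"
proof -
  define m where "m = card (contained S)"
  define X where "X = {{port A B, port B A} | A B. A \<in> contained S \<and> B \<in> contained S \<and> A \<noteq> B}"
  have X: "X \<subseteq> induced S" unfolding X_def by (rule edges_between_subset)
  have card_X: "card X = m choose 2"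
    unfolding X_def m_def by (rule card_edges_between) (auto simp: contained_def)
  have X_eq: "X = induced S \<longleftrightarrow>
    (\<forall>A\<in>\<C>. \<forall>B\<in>\<C>. A \<noteq> B \<longrightarrow> port A B \<in> S \<longrightarrow> port B A \<in> S \<longrightarrow> A \<subseteq> S)" (is "_ \<longleftrightarrow> ?R")
  proof
    assume eq: "X = induced S"
    show ?R
    proof (intro ballI impI)
      fix A B assume AB: "A \<in> \<C>" "B \<in> \<C>" "A \<noteq> B" "port A B \<in> S" "port B A \<in> S"
      then have "{port A B, port B A} \<in> X" using port_edge by (auto simp: eq induced_def)
      then obtain C D where CD: "C \<in> \<C>" "D \<in> \<C>" "C \<subseteq> S" "D \<subseteq> S" "C \<noteq> D"
        "{port A B, port B A} = {port C D, port D C}"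
        unfolding X_def contained_def by blast
      then have "port A B \<in> C \<or> port A B \<in> D" using port_in by (metis doubleton_eq_iff)
      then have "A = C \<or> A = D" using AB CD port_in component_unique by metis
      then show "A \<subseteq> S" using CD by blast
    qed
  next
    assume R: ?R
    have "induced S \<subseteq> X"
    proof
      fix e assume e: "e \<in> induced S"
      then have "e \<in> E" "e \<subseteq> S" by (auto simp: induced_def)
      from \<open>e \<in> E\<close> obtain A B where AB: "A \<in> \<C>" "B \<in> \<C>" "A \<noteq> B" "e = {port A B, port B A}"
        by (rule edgeE)
      have "port A B \<in> S" "port B A \<in> S" using AB(4) \<open>e \<subseteq> S\<close> by auto
      then have "A \<subseteq> S" "B \<subseteq> S" using R AB(1-3) by metis+
      then show "e \<in> X" using AB unfolding X_def contained_def by blast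
    qed
    then show "X = induced S" using X by blast
  qed
  have "tight S \<longleftrightarrow> (m = 1 \<or> m = 2) \<and> card X = card (induced S)"
  proof -
    have "m choose 2 \<le> card (induced S)" unfolding m_def by (rule induced_ge)
    moreover have "m \<le> m choose 2" if "3 \<le> m"
      using that by (rule le_choose_2)
    moreover have "m = 0 \<or> m = 1 \<or> m = 2 \<or> 3 \<le> m" by linarith
    ultimately show ?thesis
      unfolding tight_def m_def[symmetric] card_X by (auto simp: binomial_eq_0)
  qed
  moreover have "card X = card (induced S) \<longleftrightarrow> X = induced S"
    using X by (metis card_subset_eq finite)
  ultimately show ?thesis using X_eq unfolding m_def by blast
qed

text \<open>The source of all tight sets used below: \<open>M\<close> becomes the family of
  contained components and \<open>Z\<close> supplies additional nodes. Since no edge runs within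
  \<open>Z\<close> or from \<open>Z\<close> to \<open>M\<close>, only edges between members of
  \<open>M\<close> are induced.\<close>

lemma tight_Union:
  assumes M: "M \<subseteq> \<C>" "card M = 1 \<or> card M = 2"
    and Z: "\<And>C. C \<in> \<C> \<Longrightarrow> \<not> C \<subseteq> Z"
    and ports: "\<And>C D. \<lbrakk>C \<in> \<C>; D \<in> \<C>; C \<noteq> D; port C D \<in> Z; D \<in> M \<or> port D C \<in> Z\<rbrakk> \<Longrightarrow> False"
  shows "tight (\<Union>M \<union> Z)"
proof -
  have outside: "C \<inter> \<Union>M = {}" if "C \<in> \<C>" "C \<notin> M" for C
    using that M(1) component_unique by blast
  have "C \<in> M" if "C \<in> \<C>" "C \<subseteq> \<Union>M \<union> Z" for C
    using outside[OF that(1)] that(2) Z[OF that(1)] by blast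
  then have "contained (\<Union>M \<union> Z) = M" using M(1) by (auto simp: contained_def)
  moreover have "C \<subseteq> \<Union>M \<union> Z"
    if *: "C \<in> \<C>" "D \<in> \<C>" "C \<noteq> D" "port C D \<in> \<Union>M \<union> Z" "port D C \<in> \<Union>M \<union> Z" for C D
  proof (cases "C \<in> M")
    case False
    have "port C D \<in> Z" using outside[OF *(1) False] port_in[OF *(1-3)] *(4) by blast
    moreover have "D \<in> M \<or> port D C \<in> Z"
      using outside[OF *(2)] port_in[OF *(2,1) not_sym[OF *(3)]] *(5) by blast
    ultimately show ?thesis using ports *(1-3) by blast
  qed blast
  ultimately show ?thesis using M(2) unfolding tight_iff by auto
qed

section \<open>Degrees and forms vanishing on tight sets\<close>

lemma componentE:
  assumes "C \<in> \<C>" "z \<in> C"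
  obtains "C = {z}" | z' where "C = {z, z'}" "z' \<noteq> z"
  using card_component[OF assms(1)] assms(2) by (auto simp: card_1_singleton_iff card_2_iff)

text \<open>The degree condition is exploited in this form: a node is attached to some component
  other than a prescribed \<open>B\<close>.\<close>

lemma other_port:
  assumes "graph_degree E y \<ge> 2" "A \<in> \<C>" "y \<in> A"
  obtains D where "D \<in> \<C>" "D \<noteq> A" "D \<noteq> B" "port A D = y"
proof -
  have "\<not> {D \<in> \<C>. D \<noteq> A \<and> port A D = y} \<subseteq> {B}"
    using assms card_mono[of "{B}" "{D \<in> \<C>. D \<noteq> A \<and> port A D = y}"] graph_degree_port[of A y] by auto
  then show ?thesis using that by blast
qed

text \<open>The entries are eliminated from coarse to fine: blocks of components, diagonal entries,
  a node against a component, two nodes of different components, and last the two nodes of one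
  component.\<close>

lemma form_vanishes:
  fixes b :: "'v \<Rightarrow> 'v \<Rightarrow> real"
  assumes sym: "\<And>u v. b u v = b v u"
    and deg: "\<And>v. graph_degree E v \<ge> 2"
    and zero: "\<And>S. tight S \<Longrightarrow> (\<Sum>u\<in>S. \<Sum>v\<in>S. b u v) = 0"
  shows "b u v = 0"
proof -
  define q where "q X Y = (\<Sum>u\<in>X. \<Sum>v\<in>Y. b u v)" for X Y
  have q_sym: "q X Y = q Y X" for X Y
    unfolding q_def by (subst sum.swap) (simp add: sym)
  have q_Un: "q (X \<union> Y) (X \<union> Y) = q X X + q Y Y + 2 * q X Y" if "X \<inter> Y = {}" for X Y
  proof -
    have "q (X \<union> Y) (X \<union> Y) = q X X + q X Y + (q Y X + q Y Y)"
      using that by (simp add: q_def sum.union_disjoint sum.distrib)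
    then show ?thesis using q_sym[of Y X] by simp
  qed
  have q_Un_right: "q X (Y \<union> Z) = q X Y + q X Z" if "Y \<inter> Z = {}" for X Y Z
    using that by (simp add: q_def sum.union_disjoint sum.distrib)
  have q_pt: "q {x} {y} = b x y" for x y by (simp add: q_def)
  have q_tight: "q S S = 0" if "tight S" for S using zero that by (simp add: q_def)
  have disj: "A \<inter> B = {}" if "A \<in> \<C>" "B \<in> \<C>" "A \<noteq> B" for A B
    using component_unique that by blast
  have nonempty: "C \<noteq> {}" if "C \<in> \<C>" for C using card_component[OF that] by auto

  have diag: "q A A = 0" if A: "A \<in> \<C>" for A
    using q_tight[OF tight_Union[of "{A}" "{}"]] A nonempty by auto
  have cross: "q A B = 0" if AB: "A \<in> \<C>" "B \<in> \<C>" "A \<noteq> B" for A B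
  proof -
    have "q (A \<union> B) (A \<union> B) = 0"
      using q_tight[OF tight_Union[of "{A, B}" "{}"]] AB nonempty by auto
    then show ?thesis using q_Un[OF disj[OF AB]] diag AB by simp
  qed
  \<comment> \<open>The node \<open>z\<close> can join the components in \<open>M\<close> without
    inducing an edge, since all their edges into \<open>C\<close> end at its partner
    \<open>z'\<close>.\<close>
  have add_pt: "q (\<Union>M) (\<Union>M) + b z z + 2 * q {z} (\<Union>M) = 0"
    if C: "C \<in> \<C>" "C = {z, z'}" "z' \<noteq> z"
      and M: "M \<subseteq> \<C>" "card M = 1 \<or> card M = 2" "\<And>A. A \<in> M \<Longrightarrow> A \<noteq> C \<and> port C A = z'"
    for C z z' M
  proof -
    have z: "D = C" if "D \<in> \<C>" "z \<in> D" for D using that C component_unique by blast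
    have "tight (\<Union>M \<union> {z})"
    proof (rule tight_Union[OF M(1,2)])
      show "\<not> D \<subseteq> {z}" if "D \<in> \<C>" for D
      proof
        assume "D \<subseteq> {z}"
        then have "D = {z}" using nonempty[OF that] by blast
        then show False using z[OF that] C by auto
      qed
      show False if D: "D \<in> \<C>" "D' \<in> \<C>" "D \<noteq> D'" "port D D' \<in> {z}" "D' \<in> M \<or> port D' D \<in> {z}"
        for D D'
      proof -
        have "D = C" using z[OF D(1)] port_in[OF D(1-3)] D(4) by simp
        moreover have "D' = C" if "port D' D \<in> {z}"
          using z[OF D(2)] port_in[OF D(2,1) not_sym[OF D(3)]] that by simp
        ultimately show False using D(3-5) M(3)[of D'] C(3) by auto
      qed
    qed
    moreover have "\<Union>M \<inter> {z} = {}" using M(1,3) z by blast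
    ultimately have "q (\<Union>M) (\<Union>M) + q {z} {z} + 2 * q (\<Union>M) {z} = 0"
      using q_tight[of "\<Union>M \<union> {z}"] q_Un[of "\<Union>M" "{z}"] by simp
    then show ?thesis using q_pt[of z z] q_sym[of "\<Union>M" "{z}"] by simp
  qed
  have add1: "b z z + 2 * q {z} A = 0"
    if "A \<in> \<C>" "C \<in> \<C>" "A \<noteq> C" "C = {z, z'}" "z' \<noteq> z" "port C A = z'" for A C z z'
    using add_pt[of C z z' "{A}"] diag[of A] that by simp
  \<comment> \<open>Compare adding \<open>z\<close> to each of two components attached to \<open>z'\<close> with adding it to their union.\<close>
  have diag_pt: "b z z = 0" for z
  proof -
    obtain C where C: "C \<in> \<C>" "z \<in> C" using component_ex by blast
    show ?thesis
    proof (cases rule: componentE[OF C])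
      case 1
      then show ?thesis using diag[OF C(1)] by (simp add: q_def)
    next
      case (2 z')
      then have z': "z' \<in> C" by simp
      obtain A where A: "A \<in> \<C>" "A \<noteq> C" "port C A = z'"
        using other_port[OF deg C(1) z'] by metis
      obtain B where B: "B \<in> \<C>" "B \<noteq> C" "B \<noteq> A" "port C B = z'"
        using other_port[OF deg C(1) z', of A] by metis
      have "q (A \<union> B) (A \<union> B) + b z z + 2 * q {z} (A \<union> B) = 0"
        using add_pt[of C z z' "{A, B}"] A B C 2 by auto
      moreover have "q (A \<union> B) (A \<union> B) = 0"
        using q_Un[OF disj[of A B]] A B diag[of A] diag[of B] cross[of A B] by auto
      moreover have "q {z} (A \<union> B) = q {z} A + q {z} B"
        using disj[of A B] A B by (intro q_Un_right) auto
      ultimately show ?thesis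
        using add1[of A C z z'] add1[of B C z z'] A B C 2 by simp
    qed
  qed
  have pt_comp: "q {z} A = 0" if *: "A \<in> \<C>" "C \<in> \<C>" "A \<noteq> C" "z \<in> C" for A C z
  proof (cases rule: componentE[OF *(2,4)])
    case 1
    then show ?thesis using cross * by metis
  next
    case (2 z')
    show ?thesis
    proof (cases "port C A = z'")
      case True
      then show ?thesis using add1[of A C z z'] * 2 diag_pt by simp
    next
      case False
      \<comment> \<open>The roles are swapped: \<open>z\<close> carries the edge, so
        \<open>add1\<close> treats the partner \<open>z'\<close>, and \<open>cross\<close> transfers
        the result to \<open>z\<close>.\<close>
      then have "port C A = z" using port_in * 2 by blast
      then have "q {z'} A = 0" using add1[of A C z' z] * 2 diag_pt by (auto simp: insert_commute)
      moreover have "q A C = q A {z} + q A {z'}"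
        using q_Un_right[of "{z}" "{z'}" A] 2 by (simp add: insert_commute)
      ultimately show ?thesis using cross * q_sym by force
    qed
  qed
  have key: "b y z = 0" if *: "A \<in> \<C>" "C \<in> \<C>" "A \<noteq> C" "y \<in> A" "z \<in> C" for A C y z
  proof (cases rule: componentE[OF *(1,4)])
    case 1
    then show ?thesis using pt_comp[of A C z] * q_pt sym by metis
  next
    case y': (2 y')
    show ?thesis
    proof (cases rule: componentE[OF *(2,5)])
      case 1
      then show ?thesis using pt_comp[of C A y] * q_pt by metis
    next
      case z': (2 z')
      have row: "b x z + b x z' = 0" if "x \<in> A" for x
        using pt_comp[of C A x] that * z' by (simp add: q_def)
      have col: "b y x + b y' x = 0" if "x \<in> C" for x
        using pt_comp[of A C x] that * y' sym by (simp add: q_def)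
      \<comment> \<open>The four entries agree up to sign, so it suffices that the entry at \<open>p'\<close>, \<open>r'\<close> is zero.\<close>
      have eqs: "b y z + b y z' = 0" "b y' z + b y' z' = 0" "b y z + b y' z = 0" "b y z' + b y' z' = 0"
        using row col y' z' by auto
      have other: "\<exists>x'. X = {x, x'} \<and> x' \<noteq> x" if "X = {c, d}" "d \<noteq> c" "x \<in> X"
        for X :: "'v set" and x c d
        using that by auto
      have p: "port A C \<in> A" using port_in[OF *(1-3)] .
      obtain p' where p': "A = {port A C, p'}" "p' \<noteq> port A C"
        using other[OF y' p] by blast
      \<comment> \<open>Since \<open>D\<close> is attached to the same node of \<open>A\<close> as
        \<open>C\<close>, the other node \<open>p'\<close> has no edge to \<open>C\<close> or
        \<open>D\<close>. Taking \<open>r'\<close> to be the node of \<open>C\<close> away from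
        \<open>D\<close> makes \<open>D \<union> {p', r'}\<close> tight, and only the entry at
        \<open>p'\<close>, \<open>r'\<close> survives in its form.\<close>
      obtain D where D: "D \<in> \<C>" "D \<noteq> A" "D \<noteq> C" "port A D = port A C"
        using other_port[OF deg *(1) p, of C] by metis
      have r: "port C D \<in> C" using port_in[OF *(2) D(1)] D(3) by simp
      obtain r' where r': "C = {port C D, r'}" "r' \<noteq> port C D"
        using other[OF z' r] by blast
      have mem: "p' \<in> A" "r' \<in> C" using p'(1) r'(1) by blast+
      have only_p': "B = A" if "B \<in> \<C>" "p' \<in> B" for B
        by (rule component_unique[OF that(1) *(1) that(2) mem(1)])
      have only_r': "B = C" if "B \<in> \<C>" "r' \<in> B" for B
        by (rule component_unique[OF that(1) *(2) that(2) mem(2)])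
      have notin: "p' \<notin> D" "r' \<notin> D" "p' \<noteq> r'"
        using only_p'[OF D(1)] only_r'[OF D(1)] only_p'[OF *(2)] mem D(2,3) *(3) by auto
      have "tight (\<Union>{D} \<union> {p', r'})"
      proof (rule tight_Union)
        show "\<not> B \<subseteq> {p', r'}" if B: "B \<in> \<C>" for B
        proof
          assume sub: "B \<subseteq> {p', r'}"
          then have "B = A \<or> B = C" using nonempty[OF B] only_p'[OF B] only_r'[OF B] by blast
          moreover have "port A C \<notin> {p', r'}" "port C D \<notin> {p', r'}"
            using p p'(2) r r'(2) only_p'[OF *(2)] only_r'[OF *(1)] *(3) by auto
          ultimately show False using sub p r by blast
        qed
        show False if B: "B \<in> \<C>" "B' \<in> \<C>" "B \<noteq> B'" "port B B' \<in> {p', r'}"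
          "B' \<in> {D} \<or> port B' B \<in> {p', r'}" for B B'
        proof -
          have pB: "port B B' \<in> B" "port B' B \<in> B'" using port_in B(1-3) by metis+
          have "B = A \<and> port B B' = p' \<or> B = C \<and> port B B' = r'"
            using only_p'[OF B(1)] only_r'[OF B(1)] pB B(4) by auto
          moreover have "B' = D \<or> B' = A \<and> port B' B = p' \<or> B' = C \<and> port B' B = r'"
            using only_p'[OF B(2)] only_r'[OF B(2)] pB B(5) by auto
          ultimately show False using B(3) p'(2) r'(2) D(4) by auto
        qed
      qed (use D in auto)
      then have "tight (D \<union> {p', r'})" by simp
      moreover have "q {p', r'} {p', r'} = 2 * b p' r'"
        using notin(3) diag_pt sym[of r'] by (simp add: q_def)
      moreover have "q D {p', r'} = 0"
      proof -
        have "q D {p'} = 0" "q D {r'} = 0"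
          using pt_comp[of D A p'] pt_comp[of D C r'] D * p' r' q_sym by auto
        then show ?thesis using q_Un_right[of "{p'}" "{r'}" D] notin(3) by (simp add: insert_commute)
      qed
      ultimately have "b p' r' = 0"
        using q_tight q_Un[of D "{p', r'}"] notin diag[OF D(1)] by fastforce
      moreover have "p' \<in> {y, y'}" "r' \<in> {z, z'}" using p' r' y' z' by auto
      ultimately show ?thesis using eqs by auto
    qed
  qed
  obtain A C where AC: "A \<in> \<C>" "u \<in> A" "C \<in> \<C>" "v \<in> C" using component_ex by metis
  show ?thesis
  proof (cases "A = C")
    case True
    show ?thesis
    proof (cases rule: componentE[OF AC(1,2)])
      case 1
      then show ?thesis using True AC diag_pt by simp
    next
      case (2 u')
      \<comment> \<open>With zero diagonal, the form on the component \<open>{u, u'}\<close> is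
        twice this entry.\<close>
      then have "b u u' = 0" using diag[OF AC(1)] diag_pt sym[of u'] by (simp add: q_def)
      then show ?thesis using 2 True AC diag_pt by auto
    qed
  qed (use key AC in blast)
qed

text \<open>Here \<open>v\<close> is the partner of \<open>u\<close> in its component and \<open>w\<close> its neighbour in \<open>G\<close>, or the extra
  node if it has none. The conclusion says that the triangle inequality
  \<open>x\<^sub>u\<^sub>w \<le> x\<^sub>u\<^sub>v + x\<^sub>v\<^sub>w\<close> holds with equality at every tight set.\<close>
lemma low_degree_triangle:
  assumes "\<not> graph_degree E u \<ge> 2"
  obtains v w where "v \<noteq> u" "w \<noteq> Some u" "w \<noteq> Some v"
    "\<And>S. tight S \<Longrightarrow> \<not> (v \<in> S \<and> u \<notin> S \<and> w \<notin> Some ` S)"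
    "\<And>S. tight S \<Longrightarrow> \<not> (v \<notin> S \<and> u \<in> S \<and> w \<in> Some ` S)"
proof -
  obtain A where A: "A \<in> \<C>" "u \<in> A" using component_ex by blast
  define N where "N = {B \<in> \<C>. B \<noteq> A \<and> port A B = u}"
  have N: "card N \<le> 1" using assms graph_degree_port[OF A] by (simp add: N_def)
  show thesis
  proof (cases rule: componentE[OF A])
    case 1
    \<comment> \<open>The node of a singleton component carries the edges to all other components,
      at least two of them, so this case cannot occur.\<close>
    then have "N = \<C> - {A}" using port_in[OF A(1)] unfolding N_def by blast
    then show ?thesis using N card_components A(1) by (simp add: card_Diff_singleton)
  next
    case (2 v)
    \<comment> \<open>A tight set contains some component \<open>C\<close>. Its edge to
      \<open>A\<close> cannot end at \<open>v\<close>, as then \<open>A \<subseteq> S\<close> would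
      put \<open>u\<close> into \<open>S\<close>; so it ends at \<open>u\<close>, and
      \<open>C\<close> belongs to \<open>N\<close>.\<close>
    have key: "\<exists>B\<in>N. port B A \<in> S" if S: "tight S" "v \<in> S" "u \<notin> S" for S
    proof -
      have "contained S \<noteq> {}" using S(1) by (auto simp: tight_iff)
      then obtain C where C: "C \<in> \<C>" "C \<subseteq> S" by (auto simp: contained_def)
      then have CA: "C \<noteq> A" using S A by blast
      have pC: "port C A \<in> S" using port_in[OF C(1) A(1) CA] C(2) by blast
      have "port A C \<noteq> v"
      proof
        assume "port A C = v"
        then have "A \<subseteq> S" using S pC CA A(1) C(1) unfolding tight_iff by metis
        then show False using S A by blast
      qed
      then have "port A C = u" using port_in[OF A(1) C(1)] CA 2 by blast
      then show ?thesis using C CA pC by (auto simp: N_def)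
    qed
    show ?thesis
    proof (cases "N = {}")
      case True
      show ?thesis using key True 2 that[of v None] by blast
    next
      case False
      then obtain B where B: "N = {B}" using N by (metis card_0_eq card_1_singletonE finite le_antisym less_one not_le)
      then have B': "B \<in> \<C>" "B \<noteq> A" "port A B = u" by (auto simp: N_def)
      define w where "w = port B A"
      have w: "w \<notin> A" using port_in[OF B'(1) A(1) B'(2)] B' A(1) component_unique unfolding w_def by blast
      have "\<not> (v \<notin> S \<and> u \<in> S \<and> w \<in> S)" if "tight S" for S
      proof
        assume *: "v \<notin> S \<and> u \<in> S \<and> w \<in> S"
        then have "A \<subseteq> S" using that B' A(1) unfolding tight_iff w_def by metis
        then show False using * 2 by blast
      qed
      then show ?thesis using key w 2 B that[of v "Some w"] by (auto simp: w_def)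
    qed
  qed
qed

end

section \<open>The inequality at cuts, and the characterisation\<close>

lemma linear_I_lhs: "linear (I_lhs E F)"
  by (rule linearI)
    (simp_all add: I_lhs_def triangle_def sum.distrib sum_subtractf sum_distrib_left algebra_simps)

lemma triangle_cut_vector:
  assumes "card e = 2"
  shows "triangle (cut_vector complete_edges (Some ` S)) (Some ` e) None = - 2 * of_bool (e \<subseteq> S)"
proof -
  obtain u v where "e = {u, v}" "u \<noteq> v" using assms by (auto simp: card_2_iff)
  then show ?thesis by (auto simp: triangle_pair cut_vector_pair)
qed

text \<open>With the extra node outside the cut set, a triangle term is -2 for an edge inside
  \<open>S\<close> and 0 otherwise. The edges of \<open>F\<close> inside \<open>S\<close> and the
  singleton components inside \<open>S\<close> together count the contained components.\<close>

lemma I_lhs_cut_vector: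
  fixes E F :: "'v::finite set set"
  assumes "graph_edges E" "graph_edges F" "pairwise disjnt F"
  shows "I_lhs E F (cut_vector complete_edges (Some ` S)) =
    2 * (real (card {C \<in> graph_components F. C \<subseteq> S}) - real (card {e \<in> E. e \<subseteq> S}))"
proof -
  define I where "I = {u. {u} \<in> graph_components F}"
  have tri: "(\<Sum>e\<in>D. triangle (cut_vector complete_edges (Some ` S)) (Some ` e) None)
      = - 2 * real (card {e \<in> D. e \<subseteq> S})" if "graph_edges D" for D :: "'v set set"
  proof -
    have "(\<Sum>e\<in>D. triangle (cut_vector complete_edges (Some ` S)) (Some ` e) None)
      = (\<Sum>e\<in>D. - 2 * of_bool (e \<subseteq> S))"
      using that by (intro sum.cong refl triangle_cut_vector) (auto simp: graph_edges_def)
    also have "\<dots> = - 2 * (\<Sum>e\<in>D. of_bool (e \<subseteq> S))" by (simp only: sum_distrib_left)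
    finally show ?thesis by (simp add: Int_def)
  qed
  have single: "(\<Sum>u\<in>I. cut_vector complete_edges (Some ` S) $ {Some u, None})
      = real (card {u \<in> I. u \<in> S})"
    by (auto simp: cut_vector_pair Int_def intro!: arg_cong[of _ _ card])
  have "{C \<in> graph_components F. C \<subseteq> S} = {e \<in> F. e \<subseteq> S} \<union> (\<lambda>u. {u}) ` {u \<in> I. u \<in> S}"
    by (auto simp: I_def graph_components_matching[OF assms(2,3)])
  moreover have "{e \<in> F. e \<subseteq> S} \<inter> (\<lambda>u. {u}) ` {u \<in> I. u \<in> S} = {}"
    using assms(2) by (auto simp: graph_edges_def)
  ultimately have "card {C \<in> graph_components F. C \<subseteq> S} = card {e \<in> F. e \<subseteq> S} + card {u \<in> I. u \<in> S}"
    by (simp add: card_Un_disjoint card_image)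
  then show ?thesis
    unfolding I_lhs_def tri[OF assms(1)] tri[OF assms(2)] I_def[symmetric] single by simp
qed

theorem theorem4:
  fixes E F :: "'v::finite set set" and W :: "nat \<Rightarrow> 'v set" and n t k :: nat
  assumes "n = CARD('v)"
    and "graph_edges E" and "graph_edges F"
    and "pairwise disjnt F"
    and "t = card F" and "k = n - t"
    and "bij_betw W {1..k} (graph_components F)"
    and "card E = k choose 2"
    and "\<And>i j. 1 \<le> i \<Longrightarrow> i < j \<Longrightarrow> j \<le> k \<Longrightarrow> \<exists>!e. e \<in> E \<and> joins e (W i) (W j)"
    and "k \<ge> 3"
  shows "defines_facet (I_lhs E F) 2 (cut_polytope :: (real ^ 'v option set) set)
     \<longleftrightarrow> (\<forall>v. graph_degree E v \<ge> 2)"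
proof -
  define \<C> where "\<C> = graph_components F"
  have \<C>: "\<C> = F \<union> {{u} | u. u \<notin> \<Union>F}"
    unfolding \<C>_def using graph_components_matching assms(3,4) by blast
  have card_\<C>: "card \<C> = k" using bij_betw_same_card[OF assms(7)] by (simp add: \<C>_def)
  have part: "partition_on UNIV \<C>"
  proof (rule partition_onI)
    show "\<Union>\<C> = UNIV" by (auto simp: \<C>)
    show "disjnt A B" if "A \<in> \<C>" "B \<in> \<C>" "A \<noteq> B" for A B
      using that assms(4) by (auto simp: \<C> pairwise_def disjnt_def)
    show "{} \<notin> \<C>" using assms(3) by (auto simp: \<C> graph_edges_def)
  qed
  then have unique: "A = B" if "A \<in> \<C>" "B \<in> \<C>" "x \<in> A" "x \<in> B" for A B x
    using that by (auto simp: partition_on_def disjoint_def)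
  have ex1: "\<exists>!e. e \<in> E \<and> joins e A B" if AB: "A \<in> \<C>" "B \<in> \<C>" "A \<noteq> B" for A B
  proof -
    have joins_sym: "joins e X Y \<longleftrightarrow> joins e Y X" for e :: "'v set" and X Y
      unfolding joins_def by (metis insert_commute)
    have "\<C> = W ` {1..k}" using assms(7) by (simp add: \<C>_def bij_betw_def)
    then obtain i j where ij: "i \<in> {1..k}" "j \<in> {1..k}" "A = W i" "B = W j"
      using AB(1,2) by blast
    then consider "i < j" | "j < i" using AB(3) by (metis linorder_neqE_nat)
    then show ?thesis
    proof cases
      case 1
      then show ?thesis using assms(9)[of i j] ij by simp
    next
      case 2
      then show ?thesis using assms(9)[of j i] ij joins_sym[of _ A B] by simp
    qed
  qed
  \<comment> \<open>Only the number of edges excludes edges inside components.\<close>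
  define ends where "ends e = {C \<in> \<C>. C \<inter> e \<noteq> {}}" for e
  have "{D. D \<subseteq> \<C> \<and> card D = 2} \<subseteq> ends ` E"
  proof
    fix D assume "D \<in> {D. D \<subseteq> \<C> \<and> card D = 2}"
    then obtain A B where AB: "D = {A, B}" "A \<in> \<C>" "B \<in> \<C>" "A \<noteq> B" by (auto simp: card_2_iff)
    then obtain u v where uv: "u \<in> A" "v \<in> B" "{u, v} \<in> E"
      using ex1 unfolding joins_def by blast
    then have "ends {u, v} = D" using AB unique unfolding ends_def by blast
    then show "D \<in> ends ` E" using uv by blast
  qed
  moreover have "card (ends ` E) \<le> card {D. D \<subseteq> \<C> \<and> card D = 2}"
    using card_image_le[of E ends] by (simp add: n_subsets card_\<C> assms(8))
  \<comment> \<open>The image contains every pair of components and has no more elements than there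
    are pairs, so each edge meets exactly two components.\<close>
  ultimately have ends_E: "ends ` E = {D. D \<subseteq> \<C> \<and> card D = 2}"
    by (metis card_seteq finite)
  have joined: "\<exists>A\<in>\<C>. \<exists>B\<in>\<C>. A \<noteq> B \<and> joins e A B" if e: "e \<in> E" for e
  proof -
    have "ends e \<subseteq> \<C>" "card (ends e) = 2" using ends_E e by blast+
    then obtain A B where AB: "ends e = {A, B}" "A \<noteq> B" "A \<in> \<C>" "B \<in> \<C>"
      by (auto simp: card_2_iff)
    then have "A \<inter> e \<noteq> {}" "B \<inter> e \<noteq> {}" unfolding ends_def by blast+
    then obtain u v where uv: "u \<in> A" "u \<in> e" "v \<in> B" "v \<in> e" by blast
    moreover have "u \<noteq> v" using unique[OF AB(3,4) uv(1)] uv(3) AB(2) by auto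
    moreover have "card e = 2" using e assms(2) by (simp add: graph_edges_def)
    ultimately have "e = {u, v}" by (auto simp: card_2_iff)
    then show ?thesis using AB uv unfolding joins_def by blast
  qed
  have "card C = 1 \<or> card C = 2" if "C \<in> \<C>" for C
    using that assms(3) by (auto simp: \<C> graph_edges_def)
  then interpret component_graph \<C> E
    using part ex1 joined card_\<C> assms(10) by unfold_locales auto
  let ?\<delta> = "\<lambda>S :: 'v set. cut_vector complete_edges (Some ` S)"
  have lhs: "I_lhs E F (?\<delta> S) = 2 * (real (card (contained S)) - real (card (induced S)))" for S
    unfolding contained_def induced_def by (rule I_lhs_cut_vector[OF assms(2-4), folded \<C>_def])
  have tight_eq: "I_lhs E F (?\<delta> S) = 2 \<longleftrightarrow> tight S" for S
  proof -
    have "I_lhs E F (?\<delta> S) = 2 \<longleftrightarrow> real (card (contained S)) = real (1 + card (induced S))"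
      unfolding lhs by auto
    then show ?thesis unfolding tight_def of_nat_eq_iff .
  qed
  have "0 = ?\<delta> {}" by (simp add: cut_vector_def vec_eq_iff)
  then have zero: "0 \<in> range ?\<delta>" by (rule range_eqI)
  have valid: "I_lhs E F (?\<delta> S) \<le> 2" for S
  proof -
    have "real (card (contained S)) \<le> real (1 + card (induced S))"
      unfolding of_nat_le_iff by (rule excess_le)
    then show ?thesis unfolding lhs by simp
  qed
  have "defines_facet (I_lhs E F) 2 (convex hull range ?\<delta>) \<longleftrightarrow>
      (\<forall>a. (\<forall>x\<in>range ?\<delta>. I_lhs E F x = 2 \<longrightarrow> a \<bullet> x = 0) \<longrightarrow> (\<forall>x\<in>range ?\<delta>. a \<bullet> x = 0))"
    by (rule facet_criterion[OF linear_I_lhs _ zero]) (use valid in auto)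
  then have facet: "defines_facet (I_lhs E F) 2 (cut_polytope :: (real ^ 'v option set) set) \<longleftrightarrow>
      (\<forall>a. (\<forall>S. tight S \<longrightarrow> a \<bullet> ?\<delta> S = 0) \<longrightarrow> (\<forall>S. a \<bullet> ?\<delta> S = 0))"
    by (simp add: cut_polytope_def range_cut_vector_option tight_eq)
  show ?thesis
  proof
    assume "defines_facet (I_lhs E F) 2 (cut_polytope :: (real ^ 'v option set) set)"
    note facet = this[unfolded facet, rule_format]
    show "\<forall>v. graph_degree E v \<ge> 2"
    proof (rule ccontr)
      assume "\<not> (\<forall>v. graph_degree E v \<ge> 2)"
      then obtain u where u: "\<not> graph_degree E u \<ge> 2" by blast
      obtain v w where vw: "v \<noteq> u" "w \<noteq> Some u" "w \<noteq> Some v"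
        "\<And>S. tight S \<Longrightarrow> \<not> (v \<in> S \<and> u \<notin> S \<and> w \<notin> Some ` S)"
        "\<And>S. tight S \<Longrightarrow> \<not> (v \<notin> S \<and> u \<in> S \<and> w \<in> Some ` S)"
        using low_degree_triangle[OF u] by blast
      \<comment> \<open>On cuts this triangle functional is 2 when \<open>v\<close> is separated
        from both \<open>u\<close> and \<open>w\<close>, and 0 otherwise. The two properties of
        \<open>v\<close> and \<open>w\<close> exclude the first case on tight sets, whereas the cut
        of \<open>{v}\<close> realises it.\<close>
      define a :: "real ^ 'v option set" where
        "a = axis {Some u, Some v} 1 + axis {Some v, w} 1 - axis {Some u, w} 1"
      have a: "a \<bullet> ?\<delta> S = of_bool ((u \<in> S) \<noteq> (v \<in> S)) + of_bool ((v \<in> S) \<noteq> (w \<in> Some ` S))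
          - of_bool ((u \<in> S) \<noteq> (w \<in> Some ` S))" for S
        using vw(1-3) by (auto simp: a_def inner_add_left inner_diff_left inner_axis' cut_vector_pair)
      have "a \<bullet> ?\<delta> S = 0" if "tight S" for S
        using vw(4,5)[OF that] by (auto simp: a)
      then have "a \<bullet> ?\<delta> {v} = 0" using facet by blast
      moreover have "a \<bullet> ?\<delta> {v} = 2" unfolding a using vw(1,3) by auto
      ultimately show False by simp
    qed
  next
    assume deg: "\<forall>v. graph_degree E v \<ge> 2"
    show "defines_facet (I_lhs E F) 2 (cut_polytope :: (real ^ 'v option set) set)"
      unfolding facet
    proof (intro allI impI)
      fix a :: "real ^ 'v option set" and S
      assume *: "\<forall>S. tight S \<longrightarrow> a \<bullet> ?\<delta> S = 0"
      obtain b where sym: "\<And>u v. b u v = b v u"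
        and b: "\<And>S. a \<bullet> ?\<delta> S = (\<Sum>u\<in>S. \<Sum>v\<in>S. b u v)"
        using inner_cut_vector_quadratic[of a] by metis
      have "b u v = 0" for u v
        by (rule form_vanishes[OF sym]) (use deg * in \<open>simp_all flip: b\<close>)
      then show "a \<bullet> ?\<delta> S = 0" by (simp add: b)
    qed
  qed
qed

end
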